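(* The set $S=\{I_{12},-D_0,F_U\}$ is a minimal involutive generating set of $ESL_5(\mathbb{F}_2)$, where $$I_{12} = \begin{pmatrix} -1 & 1 & 0 & 0 & 0\\ 0 & 1 & 0 & 0 & 0\\ 0 & 0 & 1 & 0 & 0\\ 0 & 0 & 0 & 1 & 0\\ 0 & 0 & 0 & 0 & 1\end{pmatrix},\quad -D_0 = \begin{pmatrix} 0 & 0 & 0 & 0 & 1\\ 0 & 0 & 0 & 1 & 0\\ 0 & 0 & 1 & 0 & 0\\ 0 & 1 & 0 & 0 & 0\\ 1 & 0 & 0 & 0 & 0\end{pmatrix},\quad F_U = \begin{pmatrix} 0 & 0 & 0 & 1 & 0\\ 0 & 0 & 1 & 0 & 0\\ 0 & 1 & 0 & 0 & 0\\ 1 & 0 & 0 & 0 & 0\\ 0 & 0 & 0 & 0 & 1\end{pmatrix},$$ with entries read modulo $2$.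
   Context: $ESL_n(\mathbb{F}_p)$ denotes the group of all $n\times n$ matrices over $\mathbb{F}_p$ with determinant $1$ or $-1$. An involutive generating set of a group is a generating set all of whose elements are involutions (elements of order $2$); it is minimal if no involutive generating set of smaller cardinality exists. *)

theory Defs
  imports
    "Jordan_Normal_Form.Determinant"
    "HOL-Algebra.Multiplicative_Group"
    "HOL-Algebra.Generated_Groups"
    "HOL-Library.Equipollence"
    "HOL-Library.Z2"
begin

text \<open>The field of scalars is the element type; for the field with two elements take \<^typ>\<open>bit\<close>.\<close>

definition ESL :: "nat \<Rightarrow> 'a::field mat monoid" where
  "ESL n = \<lparr>carrier = {A \<in> carrier_mat n n. det A = 1 \<or> det A = - 1},
            mult = (*), one = 1\<^sub>m n\<rparr>"

lemma group_ESL: "group (ESL n :: 'a::field mat monoid)"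
proof (rule groupI)
  fix A :: "'a mat" assume "A \<in> carrier (ESL n)"
  then have A: "A \<in> carrier_mat n n" and dA: "det A = 1 \<or> det A = - 1"
    by (auto simp: ESL_def)
  have "A \<in> Units (ring_mat TYPE('a) n ())"
    using det_non_zero_imp_unit[OF A, of "()"] dA by auto
  then obtain B where B: "B \<in> carrier_mat n n" and BA: "B * A = 1\<^sub>m n"
    by (auto simp: Units_def ring_mat_def)
  have "det B * det A = 1"
    using det_mult[OF B A] BA by simp
  then have "det B = 1 \<or> det B = - 1"
    using dA by (auto simp: minus_equation_iff[of "det B"])
  then show "\<exists>B\<in>carrier (ESL n). B \<otimes>\<^bsub>ESL n\<^esub> A = \<one>\<^bsub>ESL n\<^esub>"
    using B BA by (auto simp: ESL_def)
qed (auto simp: ESL_def det_mult assoc_mult_mat)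

definition involution :: "('a, 'b) monoid_scheme \<Rightarrow> 'a \<Rightarrow> bool" where
  "involution G x \<longleftrightarrow> x \<in> carrier G \<and> group.ord G x = 2"

definition involutive_generating_set :: "('a, 'b) monoid_scheme \<Rightarrow> 'a set \<Rightarrow> bool" where
  "involutive_generating_set G S \<longleftrightarrow>
     (\<forall>x\<in>S. involution G x) \<and> generate G S = carrier G"

text \<open>Cardinalities are compared by \<open>\<prec>\<close> because \<open>card\<close> sends every infinite set to \<open>0\<close>.\<close>

definition minimal_involutive_generating_set ::
    "('a, 'b) monoid_scheme \<Rightarrow> 'a set \<Rightarrow> bool" where
  "minimal_involutive_generating_set G S \<longleftrightarrow>
     involutive_generating_set G S \<and>
     (\<nexists>T. involutive_generating_set G T \<and> T \<prec> S)"

definition I12 :: "'a::ring_1 mat" where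
  "I12 = mat_of_rows_list 5
     [[- 1, 1, 0, 0, 0],
      [  0, 1, 0, 0, 0],
      [  0, 0, 1, 0, 0],
      [  0, 0, 0, 1, 0],
      [  0, 0, 0, 0, 1]]"

text \<open>This is the matrix \<open>-D\<^sub>0\<close> itself, sign included.\<close>

definition minus_D0 :: "'a::ring_1 mat" where
  "minus_D0 = mat_of_rows_list 5
     [[0, 0, 0, 0, 1],
      [0, 0, 0, 1, 0],
      [0, 0, 1, 0, 0],
      [0, 1, 0, 0, 0],
      [1, 0, 0, 0, 0]]"

definition F_U :: "'a::ring_1 mat" where
  "F_U = mat_of_rows_list 5
     [[0, 0, 0, 1, 0],
      [0, 0, 1, 0, 0],
      [0, 1, 0, 0, 0],
      [1, 0, 0, 0, 0],
      [0, 0, 0, 0, 1]]"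

end

theory Submission
  imports Defs
begin

text \<open>
  Over the field with two elements \<open>-1 = 1\<close>, so the group consists of all invertible
  matrices, and Gaussian elimination without scaling or swapping reduces each of them to the
  identity: the transvections generate (\<open>transvections_generate_ESL_bit\<close>).

  With rows and columns numbered from \<open>0\<close>, the matrix \<open>I12\<close> is the transvection adding row
  \<open>1\<close> to row \<open>0\<close>, while \<open>minus_D0\<close> and \<open>F_U\<close> are the permutation matrices of the
  reflections \<open>i \<mapsto> 4 - i\<close> and \<open>i \<mapsto> 3 - i\<close> of a pentagon with vertices labelled
  modulo \<open>5\<close>. These two reflections generate the symmetries of the pentagon, which permute
  its ten directed edges transitively. Conjugation therefore turns \<open>I12\<close> into the transvection
  of every directed edge. Two distinct vertices of a pentagon are at distance at most two, and
  the commutator of the transvections at \<open>(i, j)\<close> and \<open>(j, k)\<close> is the one at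
  \<open>(i, k)\<close>, so every transvection is reached.

  No involutive generating set is smaller, because in a group generated by at most two involutions
  all squares commute (\<open>squares_commute_if_two_involutions\<close>): such a group is dihedral,
  cyclic of order two or trivial, and its squares are rotations. Among the squares in the present group, however, are the two
  transvections at \<open>(0, 2)\<close> and \<open>(2, 0)\<close>, which do not commute
  (\<open>noncommuting_squares_ESL_bit\<close>).
\<close>

section \<open>Groups generated by two involutions\<close>

text \<open>
  Conjugation by \<open>a\<close> inverts the rotation \<open>c = a \<otimes> b\<close>. Hence every element is a
  rotation \<open>c [^] k\<close> or a reflection \<open>c [^] k \<otimes> a\<close>. Reflections square to the
  neutral element, so all squares are powers of \<open>c\<close>.
  Asking for \<open>a \<otimes> a = \<one>\<close> only, not for order two, also covers groups generated by
  fewer than two involutions.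
\<close>
lemma (in group) squares_commute_if_two_involutions:
  assumes a: "a \<in> carrier G" "a \<otimes> a = \<one>" and b: "b \<in> carrier G" "b \<otimes> b = \<one>"
    and x: "x \<in> generate G {a, b}" and y: "y \<in> generate G {a, b}"
  shows "(x \<otimes> x) \<otimes> (y \<otimes> y) = (y \<otimes> y) \<otimes> (x \<otimes> x)"
proof -
  define c where "c = a \<otimes> b"
  have c [simp]: "c \<in> carrier G" using a b by (simp add: c_def)
  note [simp] = a(1) b(1)
  have inva: "inv a = a" and invb: "inv b = b"
    using a b by (simp_all add: inv_equality)
  have b_eq: "b = c [^] (- 1 :: int) \<otimes> a"
    using a b by (simp add: int_pow_neg c_def inv_mult_group inva invb m_assoc)
  have conj: "a \<otimes> c [^] k \<otimes> a = c [^] (- k)" for k :: int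
  proof -
    have hom: "(\<lambda>x. a \<otimes> x \<otimes> a) \<in> hom G G"
    proof (rule homI)
      fix x y assume [simp]: "x \<in> carrier G" "y \<in> carrier G"
      have "a \<otimes> (x \<otimes> y) \<otimes> a = a \<otimes> x \<otimes> (a \<otimes> a) \<otimes> y \<otimes> a"
        using a(2) by (simp add: m_assoc)
      then show "a \<otimes> (x \<otimes> y) \<otimes> a = a \<otimes> x \<otimes> a \<otimes> (a \<otimes> y \<otimes> a)"
        by (simp add: m_assoc)
    qed simp
    have "a \<otimes> c \<otimes> a = (a \<otimes> a) \<otimes> b \<otimes> a"
      by (simp add: c_def m_assoc)
    also have "\<dots> = inv c"
      using a(2) by (simp add: c_def inv_mult_group inva invb)
    finally have "a \<otimes> c \<otimes> a = inv c" .
    then show ?thesis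
      using hom_int_pow[OF hom c is_group is_group, of k] by (simp add: int_pow_inv int_pow_neg)
  qed
  have swap: "a \<otimes> c [^] k = c [^] (- k) \<otimes> a" for k :: int
  proof -
    have "a \<otimes> c [^] k = a \<otimes> c [^] k \<otimes> (a \<otimes> a)" using a(2) by simp
    also have "\<dots> = (a \<otimes> c [^] k \<otimes> a) \<otimes> a" by (simp only: m_assoc a(1) c int_pow_closed m_closed)
    finally show ?thesis by (simp only: conj)
  qed
  have aa: "c [^] k \<otimes> a \<otimes> (c [^] l \<otimes> a) = c [^] (k - l)" for k l :: int
  proof -
    have "c [^] k \<otimes> a \<otimes> (c [^] l \<otimes> a) = c [^] k \<otimes> (a \<otimes> c [^] l \<otimes> a)"
      by (simp add: m_assoc)
    then show ?thesis by (simp only: conj int_pow_mult[OF c, symmetric]) simp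
  qed
  have ac: "c [^] k \<otimes> a \<otimes> c [^] l = c [^] (k - l) \<otimes> a" for k l :: int
  proof -
    have "c [^] k \<otimes> a \<otimes> c [^] l = c [^] k \<otimes> (a \<otimes> c [^] l)"
      by (simp add: m_assoc)
    also have "\<dots> = (c [^] k \<otimes> c [^] (- l)) \<otimes> a"
      by (simp only: swap m_assoc a(1) c int_pow_closed)
    finally show ?thesis by (simp only: int_pow_mult[OF c, symmetric]) simp
  qed
  have cc: "c [^] k \<otimes> c [^] l = c [^] (k + l)" for k l :: int
    by (simp add: int_pow_mult)
  have ca: "c [^] k \<otimes> (c [^] l \<otimes> a) = c [^] (k + l) \<otimes> a" for k l :: int
    by (simp add: int_pow_mult m_assoc)
  have a_form: "a = c [^] (0 :: int) \<otimes> a" by simp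
  have form: "\<exists>k :: int. z = c [^] k \<or> z = c [^] k \<otimes> a" if "z \<in> generate G {a, b}" for z
    using that
  proof (induction rule: generate.induct)
    case one
    have "\<one> = c [^] (0 :: int)" by simp
    then show ?case by blast
  next
    case (incl h)
    then show ?case using a_form b_eq by blast
  next
    case (inv h)
    then have "inv h = a \<or> inv h = b" using inva invb by auto
    then show ?case using a_form b_eq by blast
  next
    case (eng h1 h2)
    then obtain k l :: int
      where "h1 = c [^] k \<or> h1 = c [^] k \<otimes> a" "h2 = c [^] l \<or> h2 = c [^] l \<otimes> a"
      by blast
    then show ?case by (elim disjE; simp only: aa ac cc ca; blast)
  qed
  have "\<exists>k :: int. z \<otimes> z = c [^] k" if "z \<in> generate G {a, b}" for z
    using form[OF that] by (elim exE disjE; simp only: aa cc; blast)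
  then obtain k l :: int where "x \<otimes> x = c [^] k" "y \<otimes> y = c [^] l"
    using x y by blast
  then show ?thesis by (simp add: cc add.commute)
qed

lemma (in group) involution_iff:
  "involution G x \<longleftrightarrow> x \<in> carrier G \<and> x \<noteq> \<one> \<and> x \<otimes> x = \<one>"
proof (cases "x \<in> carrier G")
  case x: True
  have "ord x = 2 \<longleftrightarrow> x \<noteq> \<one> \<and> x \<otimes> x = \<one>"
  proof
    assume o: "ord x = 2"
    show "x \<noteq> \<one> \<and> x \<otimes> x = \<one>"
      using pow_ord_eq_1[OF x] ord_eq_1[OF x] x by (auto simp: o numeral_2_eq_2)
  next
    assume h: "x \<noteq> \<one> \<and> x \<otimes> x = \<one>"
    then have "x [^] (2 :: nat) = \<one>" using x by (simp add: numeral_2_eq_2)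
    then have "ord x dvd 2" using pow_eq_id[OF x] by blast
    moreover have "ord x \<noteq> 1" using h ord_eq_1[OF x] by blast
    ultimately show "ord x = 2" by (metis prime_nat_iff two_is_prime_nat)
  qed
  then show ?thesis using x by (simp add: involution_def)
qed (simp add: involution_def)

lemma (in group) squares_commute_if_fewer_than_three_involutions:
  assumes T: "involutive_generating_set G T" and less: "T \<prec> S" and S: "finite S" "card S \<le> 3"
    and x: "x \<in> carrier G" and y: "y \<in> carrier G"
  shows "(x \<otimes> x) \<otimes> (y \<otimes> y) = (y \<otimes> y) \<otimes> (x \<otimes> x)"
proof -
  have inv: "t \<in> carrier G \<and> t \<otimes> t = \<one>" if "t \<in> insert \<one> T" for t
    using T that by (auto simp: involutive_generating_set_def involution_iff)
  have "S \<approx> {..<card S}" using S(1) by (simp add: eqpoll_iff_finite_card)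
  then have "T \<prec> {..<card S}" by (rule lesspoll_eq_trans[OF less])
  then have "finite T" "card T < card S" by (simp_all add: lesspoll_iff_finite_card)
  then have "card T \<le> 2" using S(2) by simp
  \<comment> \<open>The neutral element fills the empty places when there are fewer than two generators.\<close>
  have "\<exists>a \<in> insert \<one> T. \<exists>b \<in> insert \<one> T. T \<subseteq> {a, b}"
  proof -
    consider "card T = 0" | "card T = 1" | "card T = 2" using \<open>card T \<le> 2\<close> by linarith
    then show ?thesis
      using \<open>finite T\<close> by cases (auto simp: card_1_singleton_iff card_2_iff)
  qed
  then obtain a b where ab: "a \<in> insert \<one> T" "b \<in> insert \<one> T" "T \<subseteq> {a, b}" by blast
  have "carrier G \<subseteq> generate G {a, b}"
    using T mono_generate[OF ab(3)] by (simp add: involutive_generating_set_def)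
  then show ?thesis
    using squares_commute_if_two_involutions inv[OF ab(1)] inv[OF ab(2)] x y by blast
qed

section \<open>Transvections generate the group over the field with two elements\<close>

text \<open>
  Sums of bits are to be simplified by the laws of a field, not turned into bit operations, which
  would also rewrite the addition and multiplication that \<^const>\<open>mat_addrow_gen\<close> takes as
  parameters.
\<close>
declare add_bit_eq_xor [simp del] mult_bit_eq_and [simp del]

abbreviation transvection :: "nat \<Rightarrow> nat \<Rightarrow> nat \<Rightarrow> bit mat" where
  "transvection n i j \<equiv> addrow_mat n 1 i j"

lemma carrier_ESL_bit:
  "(A :: bit mat) \<in> carrier (ESL n) \<longleftrightarrow> A \<in> carrier_mat n n \<and> det A \<noteq> 0"
  by (auto simp: ESL_def)

lemma mult_ESL [simp]: "x \<otimes>\<^bsub>ESL n\<^esub> y = x * y"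
  and one_ESL [simp]: "\<one>\<^bsub>ESL n\<^esub> = 1\<^sub>m n"
  by (simp_all add: ESL_def)

lemma transvection_in_ESL:
  "i \<noteq> j \<Longrightarrow> transvection n i j \<in> carrier (ESL n)"
  by (simp add: carrier_ESL_bit det_addrow_mat)

lemma transvection_involutive:
  assumes "i < n" "j < n" "i \<noteq> j"
  shows "transvection n i j * transvection n i j = 1\<^sub>m n"
  using addrow_mat_inv[OF assms, of "1 :: bit"] by simp

text \<open>
  As transvections are involutions here, the square of the product of two of them is their
  commutator. The identity serves twice: it produces new transvections from old ones, and it
  exhibits transvections as squares.
\<close>
lemma transvection_product_square:
  assumes "i < n" "j < n" "k < n" "i \<noteq> j" "j \<noteq> k" "i \<noteq> k"
  shows "(transvection n i j * transvection n j k) * (transvection n i j * transvection n j k)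
    = transvection n i k"
proof -
  have "(transvection n i j * transvection n j k) * (transvection n i j * transvection n j k)
    = transvection n i j * (transvection n j k * (transvection n i j * transvection n j k))"
    by (rule assoc_mult_mat[of _ n n _ n _ n]) auto
  also have "\<dots> = addrow 1 i j (addrow 1 j k (addrow 1 i j (transvection n j k)))"
    using assms by (simp add: addrow_mat[of _ n n, symmetric])
  also have "\<dots> = transvection n i k"
    by (rule eq_matI) (use assms in \<open>auto simp: if_distrib\<close>)
  finally show ?thesis .
qed

text \<open>
  If the entries of column \<open>k\<close> from the diagonal downwards all vanished, the column would
  be a combination of the \<open>k\<close> unit columns before it, and the coefficients would form a
  nonzero vector \<open>v\<close> in the kernel of \<open>A\<close>.
\<close>
lemma pivot_exists:
  fixes A :: "'a::field mat"
  assumes A: "A \<in> carrier_mat n n" "det A \<noteq> 0" and k: "k < n"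
    and unit: "\<And>i j. i < n \<Longrightarrow> j < k \<Longrightarrow> A $$ (i, j) = (if i = j then 1 else 0)"
  shows "\<exists>i. k \<le> i \<and> i < n \<and> A $$ (i, k) \<noteq> 0"
proof (rule ccontr)
  assume "\<not> ?thesis"
  then have zero: "A $$ (i, k) = 0" if "k \<le> i" "i < n" for i using that by blast
  define v where "v = vec n (\<lambda>j. if j < k then - A $$ (j, k) else if j = k then 1 else 0)"
  have "v \<in> carrier_vec n" by (simp add: v_def)
  moreover have "v \<noteq> 0\<^sub>v n"
  proof
    assume "v = 0\<^sub>v n"
    then have "v $ k = 0" using k by simp
    then show False using k by (simp add: v_def)
  qed
  moreover have "A *\<^sub>v v = 0\<^sub>v n"
  proof (rule eq_vecI)
    fix i assume "i < dim_vec (0\<^sub>v n :: 'a vec)"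
    then have i: "i < n" by simp
    have "(A *\<^sub>v v) $ i = (\<Sum>j<n. A $$ (i, j) * v $ j)"
      using A i by (simp add: scalar_prod_def v_def lessThan_atLeast0)
    also have "\<dots> = (\<Sum>j<n. if j = k then A $$ (i, k)
        else if j = i then (if i < k then - A $$ (i, k) else 0) else 0)"
      by (rule sum.cong) (use unit i in \<open>auto simp: v_def\<close>)
    also have "\<dots> = 0"
    proof (cases "i < k")
      case True
      have "(\<Sum>j<n. if j = k then A $$ (i, k)
        else if j = i then (if i < k then - A $$ (i, k) else 0) else 0)
        = (\<Sum>j<n. (if j = k then A $$ (i, k) else 0) + (if j = i then - A $$ (i, k) else 0))"
        by (rule sum.cong) (use True in auto)
      then show ?thesis using i k by (simp add: sum.distrib)
    next
      case False
      then show ?thesis using zero[of i] i by (intro sum.neutral) auto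
    qed
    finally show "(A *\<^sub>v v) $ i = 0\<^sub>v n $ i" using i by simp
  qed (use A in auto)
  ultimately show False
    using det_0_iff_vec_prod_zero[OF A(1)] A(2) by blast
qed

text \<open>
  Gaussian elimination, by descending induction on the number \<open>k\<close> of leading columns that
  already agree with the identity. If the diagonal entry of column \<open>k\<close> is \<open>0\<close>, a pivot row
  is not swapped into place but added to row \<open>k\<close>, which makes that entry \<open>1\<close> since \<open>0\<close>
  and \<open>1\<close> are the only scalars.
  A row of index at least \<open>k\<close> is zero in the first \<open>k\<close> columns, so adding it to
  another row leaves these columns alone.
\<close>
lemma transvections_generate_ESL_bit:
  assumes H: "subgroup H (ESL n :: bit mat monoid)"
    and trans: "\<And>i j. i < n \<Longrightarrow> j < n \<Longrightarrow> i \<noteq> j \<Longrightarrow> transvection n i j \<in> H"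
  shows "H = carrier (ESL n)"
proof
  show "H \<subseteq> carrier (ESL n)" using H by (rule subgroup.subset)
  have addrow_carrier: "addrow 1 i j A \<in> carrier (ESL n)"
    if "A \<in> carrier (ESL n)" "i < n" "j < n" "i \<noteq> j" for i j and A :: "bit mat"
    using that by (simp add: carrier_ESL_bit det_addrow[of _ n])
  have addrow_H: "A \<in> H"
    if "addrow 1 i j A \<in> H" "A \<in> carrier (ESL n)" "i < n" "j < n" "i \<noteq> j" for i j A
  proof -
    have A: "A \<in> carrier_mat n n" using that by (simp add: carrier_ESL_bit)
    have "transvection n i j * addrow 1 i j A = (transvection n i j * transvection n i j) * A"
      using A that by (simp add: addrow_mat[OF A] assoc_mult_mat[of _ n n _ n _ n])
    then have "transvection n i j * addrow 1 i j A = A"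
      using A that by (simp add: transvection_involutive)
    then show ?thesis
      using subgroup.m_closed[OF H trans[of i j] that(1)] that by simp
  qed
  have "A \<in> H" if "A \<in> carrier (ESL n)" "k \<le> n"
    "\<And>i j. i < n \<Longrightarrow> j < k \<Longrightarrow> A $$ (i, j) = (if i = j then 1 else 0)" for k A
    using that(2,1,3)
  proof (induction k arbitrary: A rule: inc_induct)
    case base
    then have "A = 1\<^sub>m n" by (intro eq_matI) (auto simp: carrier_ESL_bit)
    then show ?case using subgroup.one_closed[OF H] by simp
  next
    case (step k)
    \<comment> \<open>Once the diagonal entry is \<open>1\<close>, each addition of row \<open>k\<close> to another row
      removes one of the remaining nonzero entries of column \<open>k\<close>.\<close>
    have clear: "B \<in> H" if "B \<in> carrier (ESL n)" "B $$ (k, k) = 1"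
      "\<And>i j. i < n \<Longrightarrow> j < k \<Longrightarrow> B $$ (i, j) = (if i = j then 1 else 0)" for B
      using that
    proof (induction "card {i. i < n \<and> i \<noteq> k \<and> B $$ (i, k) \<noteq> 0}" arbitrary: B rule: less_induct)
      case less
      have B: "B \<in> carrier_mat n n" using less.prems by (simp add: carrier_ESL_bit)
      show ?case
      proof (cases "\<exists>i. i < n \<and> i \<noteq> k \<and> B $$ (i, k) \<noteq> 0")
        case True
        then obtain i where i: "i < n" "i \<noteq> k" "B $$ (i, k) = 1" by auto
        let ?B = "addrow 1 i k B"
        have entry: "?B $$ (l, j) = (if l = i then B $$ (k, j) + B $$ (i, j) else B $$ (l, j))"
          if "l < n" "j < n" for l j
          using that B by auto
        have "{l. l < n \<and> l \<noteq> k \<and> ?B $$ (l, k) \<noteq> 0}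
            = {l. l < n \<and> l \<noteq> k \<and> B $$ (l, k) \<noteq> 0} - {i}"
          using i less.prems(2) step.hyps by (auto simp: entry split: if_splits)
        moreover have "card ({l. l < n \<and> l \<noteq> k \<and> B $$ (l, k) \<noteq> 0} - {i})
            < card {l. l < n \<and> l \<noteq> k \<and> B $$ (l, k) \<noteq> 0}"
          using i by (intro card_Diff1_less) auto
        ultimately have "card {l. l < n \<and> l \<noteq> k \<and> ?B $$ (l, k) \<noteq> 0}
            < card {l. l < n \<and> l \<noteq> k \<and> B $$ (l, k) \<noteq> 0}"
          by (simp only:)
        then have "?B \<in> H"
        proof (rule less.hyps)
          show "?B \<in> carrier (ESL n)"
            by (rule addrow_carrier) (use less.prems(1) i step.hyps in simp_all)
          show "?B $$ (k, k) = 1"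
            using entry[of k k] step.hyps i(2) less.prems(2) by auto
          show "?B $$ (l, j) = (if l = j then 1 else 0)" if "l < n" "j < k" for l j
            using entry[of l j] less.prems(3)[of l j] less.prems(3)[of k j] that step.hyps
            by (simp split: if_splits)
        qed
        then show ?thesis using addrow_H i less.prems(1) step.hyps by blast
      next
        case False
        show ?thesis
        proof (rule step.IH)
          fix i j assume ij: "i < n" "j < Suc k"
          show "B $$ (i, j) = (if i = j then 1 else 0)"
            using False less.prems ij by (cases "j = k") auto
        qed (use less.prems in auto)
      qed
    qed
    have A: "A \<in> carrier_mat n n" using step.prems by (simp add: carrier_ESL_bit)
    obtain i where i: "k \<le> i" "i < n" "A $$ (i, k) \<noteq> 0"
      using pivot_exists[of A n k] step by (auto simp: carrier_ESL_bit)
    show ?case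
    proof (cases "A $$ (k, k) = 1")
      case True
      then show ?thesis using clear step.prems by blast
    next
      case False
      with i have ik: "k \<noteq> i" by auto
      have "addrow 1 k i A \<in> H"
      proof (rule clear)
        show "addrow 1 k i A \<in> carrier (ESL n)"
          using addrow_carrier step i ik by simp
      qed (use i ik A False step in auto)
      then show ?thesis using addrow_H step i ik by blast
    qed
  qed
  from this[of _ 0] show "carrier (ESL n) \<subseteq> H" by auto
qed

section \<open>The three matrices\<close>

definition perm_matrix :: "nat \<Rightarrow> (nat \<Rightarrow> nat) \<Rightarrow> 'a::semiring_1 mat" where
  "perm_matrix n p = mat n n (\<lambda>(i, j). if j = p i then 1 else 0)"

lemma perm_matrix_mult:
  assumes "A \<in> carrier_mat n n" "\<And>i. i < n \<Longrightarrow> p i < n"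
  shows "perm_matrix n p * A = mat n n (\<lambda>(i, j). A $$ (p i, j))"
  by (rule eq_matI) (use assms in \<open>auto simp: perm_matrix_def scalar_prod_def
    if_distrib[of "\<lambda>x. x * _"] cong: if_cong\<close>)

lemma mult_perm_matrix:
  assumes "A \<in> carrier_mat n n" "\<And>i. i < n \<Longrightarrow> p i < n" "\<And>i. i < n \<Longrightarrow> p (p i) = i"
  shows "A * perm_matrix n p = mat n n (\<lambda>(i, j). A $$ (i, p j))"
proof (rule eq_matI)
  fix i j assume "i < dim_row (mat n n (\<lambda>(i, j). A $$ (i, p j)))"
    "j < dim_col (mat n n (\<lambda>(i, j). A $$ (i, p j)))"
  then have ij: "i < n" "j < n" by auto
  have "(A * perm_matrix n p) $$ (i, j) = (\<Sum>l = 0..<n. A $$ (i, l) * (if j = p l then 1 else 0))"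
    using ij assms by (simp add: perm_matrix_def scalar_prod_def)
  also have "\<dots> = (\<Sum>l = 0..<n. if l = p j then A $$ (i, l) else 0)"
    by (rule sum.cong) (use ij assms in auto)
  finally show "(A * perm_matrix n p) $$ (i, j) = mat n n (\<lambda>(i, j). A $$ (i, p j)) $$ (i, j)"
    using ij assms by simp
qed (use assms in \<open>auto simp: perm_matrix_def\<close>)

context
  fixes n :: nat and p :: "nat \<Rightarrow> nat"
  assumes p: "\<And>i. i < n \<Longrightarrow> p i < n" "\<And>i. i < n \<Longrightarrow> p (p i) = i"
begin

lemma perm_matrix_involutive: "perm_matrix n p * perm_matrix n p = 1\<^sub>m n"
proof -
  have "perm_matrix n p \<in> carrier_mat n n" by (simp add: perm_matrix_def)
  then show ?thesis
    by (subst perm_matrix_mult) (use p in \<open>auto simp: perm_matrix_def intro!: eq_matI\<close>)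
qed

text \<open>
  The permutation matrix of an involution is its own inverse, so this is conjugation: it relabels
  rows and columns.
\<close>
lemma perm_matrix_conj_transvection:
  assumes "i < n" "j < n"
  shows "perm_matrix n p * transvection n i j * perm_matrix n p = transvection n (p i) (p j)"
proof -
  have inj: "p i = p j \<longleftrightarrow> i = j" if "i < n" "j < n" for i j using that p by metis
  have swap: "i = p j \<longleftrightarrow> p i = j" if "i < n" "j < n" for i j using that p by metis
  show ?thesis
    by (subst perm_matrix_mult, simp, simp add: p, subst mult_perm_matrix)
      (use assms p in \<open>auto intro!: eq_matI simp: inj swap\<close>)
qed

end

lemma less_5_iff: "i < 5 \<longleftrightarrow> i = 0 \<or> i = 1 \<or> i = 2 \<or> i = 3 \<or> i = (4::nat)"
  by auto

lemma I12_eq_transvection: "I12 = transvection 5 0 1"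
  by (rule eq_matI) (auto simp: I12_def mat_of_rows_list_def less_5_iff)

lemma minus_D0_eq_perm_matrix: "minus_D0 = perm_matrix 5 (\<lambda>i. 4 - i)"
  by (rule eq_matI) (auto simp: minus_D0_def perm_matrix_def mat_of_rows_list_def less_5_iff)

lemma F_U_eq_perm_matrix: "F_U = perm_matrix 5 (\<lambda>i. if i = 4 then 4 else 3 - i)"
  by (rule eq_matI) (auto simp: F_U_def perm_matrix_def mat_of_rows_list_def less_5_iff)

lemma involution_ESL_bitI:
  fixes A :: "bit mat"
  assumes "A \<in> carrier_mat n n" "A * A = 1\<^sub>m n" "A \<noteq> 1\<^sub>m n"
  shows "involution (ESL n) A"
proof -
  have "det A * det A = 1" using det_mult[OF assms(1,1)] assms(2) by simp
  then have "det A \<noteq> 0" by (metis mult_zero_left zero_neq_one)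
  then have "A \<in> carrier (ESL n)" using assms(1) by (simp add: carrier_ESL_bit)
  then show ?thesis using assms by (simp add: group.involution_iff[OF group_ESL])
qed

lemma generating_matrices_involutions:
  assumes "A \<in> {I12, minus_D0, F_U :: bit mat}"
  shows "involution (ESL 5) A"
proof (rule involution_ESL_bitI)
  show "A \<in> carrier_mat 5 5"
    using assms by (auto simp: I12_eq_transvection minus_D0_eq_perm_matrix F_U_eq_perm_matrix
      perm_matrix_def)
  show "A * A = 1\<^sub>m 5"
    using assms unfolding I12_eq_transvection minus_D0_eq_perm_matrix F_U_eq_perm_matrix
    by (auto simp: transvection_involutive intro!: perm_matrix_involutive)
  \<comment> \<open>The two permutations move \<open>0\<close>, and the transvection has a \<open>1\<close> at \<open>(0, 1)\<close>.\<close>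
  have "A $$ (0, 0) \<noteq> (1\<^sub>m 5 :: bit mat) $$ (0, 0) \<or> A $$ (0, 1) \<noteq> (1\<^sub>m 5 :: bit mat) $$ (0, 1)"
    using assms by (auto simp: I12_eq_transvection minus_D0_eq_perm_matrix F_U_eq_perm_matrix
      perm_matrix_def)
  then show "A \<noteq> 1\<^sub>m 5" by auto
qed

lemma generating_matrices_generate:
  "generate (ESL 5) {I12, minus_D0, F_U} = carrier (ESL 5 :: bit mat monoid)"
proof -
  let ?H = "generate (ESL 5) {I12, minus_D0, F_U :: bit mat}"
  interpret group "ESL 5 :: bit mat monoid" by (rule group_ESL)
  have H: "subgroup ?H (ESL 5)"
    using generating_matrices_involutions
    by (intro generate_is_subgroup) (auto simp: involution_def)
  have mult: "A * B \<in> ?H" if "A \<in> ?H" "B \<in> ?H" for A B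
    using subgroup.m_closed[OF H that] by simp
  have gens: "I12 \<in> ?H" "minus_D0 \<in> ?H" "F_U \<in> ?H" by (auto intro: generate.incl)
  have D: "transvection 5 (4 - i) (4 - j) \<in> ?H" if "transvection 5 i j \<in> ?H" "i < 5" "j < 5" for i j
  proof -
    have "minus_D0 * transvection 5 i j * minus_D0 = transvection 5 (4 - i) (4 - j)"
      unfolding minus_D0_eq_perm_matrix
      by (rule perm_matrix_conj_transvection) (use that(2,3) in auto)
    then show ?thesis using mult[OF mult[OF gens(2) that(1)] gens(2)] by (simp only:)
  qed
  have F: "transvection 5 (if i = 4 then 4 else 3 - i) (if j = 4 then 4 else 3 - j) \<in> ?H"
    if "transvection 5 i j \<in> ?H" "i < 5" "j < 5" for i j
  proof -
    have "F_U * transvection 5 i j * F_U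
        = transvection 5 (if i = 4 then 4 else 3 - i) (if j = 4 then 4 else 3 - j)"
      unfolding F_U_eq_perm_matrix
      by (rule perm_matrix_conj_transvection) (use that(2,3) in auto)
    then show ?thesis using mult[OF mult[OF gens(3) that(1)] gens(3)] by (simp only:)
  qed
  \<comment> \<open>The two reflections, applied alternately, lead from the edge \<open>(0, 1)\<close> through all ten
    directed edges of the pentagon.\<close>
  have 01: "transvection 5 0 1 \<in> ?H" using gens(1) by (simp add: I12_eq_transvection)
  have 43: "transvection 5 4 3 \<in> ?H" using D[OF 01] by simp
  have 40: "transvection 5 4 0 \<in> ?H" using F[OF 43] by simp
  have 04: "transvection 5 0 4 \<in> ?H" using D[OF 40] by simp
  have 34: "transvection 5 3 4 \<in> ?H" using F[OF 04] by simp
  have 10: "transvection 5 1 0 \<in> ?H" using D[OF 34] by simp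
  have 23: "transvection 5 2 3 \<in> ?H" using F[OF 10] by simp
  have 21: "transvection 5 2 1 \<in> ?H" using D[OF 23] by simp
  have 12: "transvection 5 1 2 \<in> ?H" using F[OF 21] by simp
  have 32: "transvection 5 3 2 \<in> ?H" using D[OF 12] by simp
  note neighbours = 01 43 40 04 34 10 23 21 12 32
  have two: "transvection 5 i k \<in> ?H"
    if "transvection 5 i j \<in> ?H" "transvection 5 j k \<in> ?H"
      "i < 5" "j < 5" "k < 5" "i \<noteq> j" "j \<noteq> k" "i \<noteq> k" for i j k
    using mult[OF mult[OF that(1,2)] mult[OF that(1,2)]] transvection_product_square[of i 5 j k] that
    by simp
  \<comment> \<open>Each remaining pair of vertices has a common neighbour.\<close>
  have distant: "transvection 5 0 2 \<in> ?H" "transvection 5 2 0 \<in> ?H"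
    "transvection 5 1 3 \<in> ?H" "transvection 5 3 1 \<in> ?H"
    "transvection 5 2 4 \<in> ?H" "transvection 5 4 2 \<in> ?H"
    "transvection 5 3 0 \<in> ?H" "transvection 5 0 3 \<in> ?H"
    "transvection 5 4 1 \<in> ?H" "transvection 5 1 4 \<in> ?H"
    using two[OF 01 12] two[OF 21 10] two[OF 12 23] two[OF 32 21] two[OF 23 34] two[OF 43 32]
      two[OF 34 40] two[OF 04 43] two[OF 40 01] two[OF 10 04] by simp_all
  show ?thesis
  proof (rule transvections_generate_ESL_bit[OF H])
    fix i j :: nat assume "i < 5" "j < 5" "i \<noteq> j"
    then show "transvection 5 i j \<in> ?H"
      using neighbours distant unfolding less_5_iff by (elim disjE) simp_all
  qed
qed

lemma noncommuting_squares_ESL_bit: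
  assumes "n \<ge> 3"
  shows "\<exists>x \<in> carrier (ESL n :: bit mat monoid). \<exists>y \<in> carrier (ESL n).
    (x * x) * (y * y) \<noteq> (y * y) * (x * x)"
proof -
  interpret group "ESL n :: bit mat monoid" by (rule group_ESL)
  define x where "x = transvection n 0 1 * transvection n 1 2"
  define y where "y = transvection n 2 1 * transvection n 1 0"
  have "x \<in> carrier (ESL n)" "y \<in> carrier (ESL n)"
    unfolding x_def y_def
    using transvection_in_ESL[of 0 1 n] transvection_in_ESL[of 1 2 n]
      transvection_in_ESL[of 2 1 n] transvection_in_ESL[of 1 0 n]
      m_closed[unfolded mult_ESL] by simp_all
  moreover have "(x * x) * (y * y) = addrow 1 0 2 (transvection n 2 0)"
    "(y * y) * (x * x) = addrow 1 2 0 (transvection n 0 2)"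
    using assms unfolding x_def y_def
    by (simp_all add: transvection_product_square addrow_mat[of _ n n])
  moreover have "addrow 1 0 2 (transvection n 2 0) $$ (0, 0) \<noteq> addrow 1 2 0 (transvection n 0 2) $$ (0, 0)"
    using assms by simp
  ultimately show ?thesis by metis
qed

theorem theorem3p5:
  shows "minimal_involutive_generating_set (ESL 5 :: bit mat monoid) {I12, minus_D0, F_U}"
proof -
  interpret group "ESL 5 :: bit mat monoid" by (rule group_ESL)
  let ?S = "{I12, minus_D0, F_U :: bit mat}"
  have "involutive_generating_set (ESL 5) ?S"
    unfolding involutive_generating_set_def
    using generating_matrices_involutions generating_matrices_generate by blast
  moreover have "\<not> T \<prec> ?S" if "involutive_generating_set (ESL 5 :: bit mat monoid) T" for T
  proof
    assume "T \<prec> ?S"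
    moreover have "card ?S \<le> 3" by (simp add: card_insert_if)
    ultimately show False
      using squares_commute_if_fewer_than_three_involutions[OF that, of ?S]
        noncommuting_squares_ESL_bit[of 5] by auto
  qed
  ultimately show ?thesis unfolding minimal_involutive_generating_set_def by blast
qed

end
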